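(* Let $G$ be a group, $N$ a normal subgroup of $G$, $\Gamma = G/N$, and $p\colon G\to\Gamma$ the projection. Let $\rho\colon G\to \mathrm{Homeo}_+(S^1)$ be a homomorphism such that $\rho^*e_{\mathbb{R}}\in \mathrm{H}^2(G;\mathbb{R})$ lies in the image of $p^*\colon \mathrm{H}^2(\Gamma;\mathbb{R})\to \mathrm{H}^2(G;\mathbb{R})$. Let $A\in C^2(\Gamma;\mathbb{R})$ be a normalized $2$-cocycle and $u\in C^1(G;\mathbb{R})$ a $1$-cochain with $\rho^*\chi_b-p^*A=\delta u$, and let $\nu_{\rho,A,u}=u|_N\in \mathrm{Q}(N)^G$. Assume that the second bounded cohomology group $\mathrm{H}_b^2(\Gamma;\mathbb{R})$ is trivial. If $\rho^*e_{\mathbb{R}}\neq 0$ in $\mathrm{H}^2(G;\mathbb{R})$, then $\nu_{\rho,A,u}$ is non-zero in $\mathrm{W}(G,N)$. In particular, if $\rho^*e_{\mathbb{R}}\ne 0$, then $\nu_{\rho,A,u}$ is non-extendable to $G$, that is, it is not the restriction to $N$ of a homogeneous quasimorphism on $G$.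
   Context: A homogeneous quasimorphism on a group $K$ is a function $\mu\colon K\to\mathbb{R}$ with $D(\mu)=\sup_{g,h\in K}|\mu(gh)-\mu(g)-\mu(h)|<\infty$ and $\mu(g^n)=n\mu(g)$ for all $g\in K$, $n\in\mathbb{Z}$; $\mathrm{Q}(K)$ is the real vector space of these. For $N$ normal in $G$, $\mathrm{Q}(N)^G$ is the space of $\mu\in\mathrm{Q}(N)$ with $\mu(gxg^{-1})=\mu(x)$ for all $g\in G,x\in N$; $\mathrm{H}^1(N;\mathbb{R})^G$ is the space of homomorphisms $N\to\mathbb{R}$ invariant under $G$-conjugation; $i\colon N\to G$ is the inclusion; and $\mathrm{W}(G,N)=\mathrm{Q}(N)^G/(\mathrm{H}^1(N;\mathbb{R})^G+i^*\mathrm{Q}(G))$. $C^n(K;\mathbb{R})$ is the space of functions $K^n\to\mathbb{R}$ with the usual inhomogeneous coboundary $\delta$, e.g. $\delta u(g,h)=u(h)-u(gh)+u(g)$; $\mathrm{H}^*(K;\mathbb{R})$ is the resulting cohomology and $\mathrm{H}^*_b(K;\mathbb{R})$ is the cohomology of the subcomplex of bounded functions. A cocycle is normalized if it vanishes whenever one of its arguments is the identity. $S^1=\mathbb{R}/\mathbb{Z}$; $\mathrm{Homeo}_+(S^1)$ is its group of orientation preserving homeomorphisms. $\widetilde{\mathcal{H}}$ is the group of homeomorphisms $\widetilde f\colon\mathbb{R}\to\mathbb{R}$ commuting with $x\mapsto x+1$, with canonical projection $\pi\colon\widetilde{\mathcal{H}}\to\mathrm{Homeo}_+(S^1)$. The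 Poincaré translation number is $\tau(\widetilde f)=\lim_{n\to\infty}\widetilde f^n(0)/n$, a homogeneous quasimorphism on $\widetilde{\mathcal{H}}$. The canonical bounded Euler cocycle is the bounded $2$-cocycle $\chi_b(f,g)=\tau(\widetilde f\widetilde g)-\tau(\widetilde f)-\tau(\widetilde g)$, where $\widetilde f,\widetilde g$ are arbitrary lifts of $f,g\in\mathrm{Homeo}_+(S^1)$. The real Euler class $e_{\mathbb{R}}\in\mathrm{H}^2(\mathrm{Homeo}_+(S^1);\mathbb{R})$ is the ordinary cohomology class of $\chi_b$. Under the assumption that $\rho^*e_{\mathbb{R}}$ is in the image of $p^*$, pairs $(A,u)$ as in the claim exist, and $u|_N$ belongs to $\mathrm{Q}(N)^G$. *)

theory Defs
  imports "HOL-Algebra.Elementary_Groups" "HOL-Analysis.Analysis"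
begin

section \<open>Spaces of real functions\<close>

text \<open>
  Throughout, a real function on a set \<open>X\<close> is represented by a function on the ambient type
  that vanishes outside \<open>X\<close>, so that equality in HOL is equality of functions on \<open>X\<close>.
  Quotients of spaces of such functions are factor groups of their additive groups;
  scalar multiplication plays no role in whether a class is zero.
\<close>

definition fun_space :: "('b \<Rightarrow> real) set \<Rightarrow> ('b \<Rightarrow> real) monoid" where
  "fun_space V = \<lparr>carrier = V, monoid.mult = (\<lambda>f g x. f x + g x), one = (\<lambda>_. 0)\<rparr>"

definition restr :: "'b set \<Rightarrow> ('b \<Rightarrow> real) \<Rightarrow> 'b \<Rightarrow> real" where
  "restr X f = (\<lambda>x. if x \<in> X then f x else 0)"


section \<open>Group cohomology with real coefficients\<close>

text \<open>An \<open>n\<close>-tuple of elements of \<open>K\<close> is a list of length \<open>n\<close>.\<close>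

definition tuples :: "('a, 'm) monoid_scheme \<Rightarrow> nat \<Rightarrow> 'a list set" where
  "tuples K n = {xs. length xs = n \<and> set xs \<subseteq> carrier K}"

definition cochains :: "('a, 'm) monoid_scheme \<Rightarrow> nat \<Rightarrow> ('a list \<Rightarrow> real) set" where
  "cochains K n = {c. \<forall>xs. xs \<notin> tuples K n \<longrightarrow> c xs = 0}"

definition bounded_cochains :: "('a, 'm) monoid_scheme \<Rightarrow> nat \<Rightarrow> ('a list \<Rightarrow> real) set" where
  "bounded_cochains K n = {c \<in> cochains K n. bounded (range c)}"

text \<open>
  The inhomogeneous coboundary: \<open>\<delta>c(g\<^sub>1,\<dots>,g\<^sub>n\<^sub>+\<^sub>1)\<close> is the alternating sum of
  \<open>c(g\<^sub>2,\<dots>,g\<^sub>n\<^sub>+\<^sub>1)\<close>, the terms \<open>c(\<dots>,g\<^sub>i g\<^sub>i\<^sub>+\<^sub>1,\<dots>)\<close>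
  for \<open>i = 1,\<dots>,n\<close> (the index below is shifted by one), and \<open>c(g\<^sub>1,\<dots>,g\<^sub>n)\<close>.
\<close>

definition coboundary ::
    "('a, 'm) monoid_scheme \<Rightarrow> nat \<Rightarrow> ('a list \<Rightarrow> real) \<Rightarrow> 'a list \<Rightarrow> real" where
  "coboundary K n c = restr (tuples K (Suc n)) (\<lambda>xs.
     c (tl xs)
     + (\<Sum>i<n. (- 1) ^ Suc i * c (take i xs @ (xs ! i \<otimes>\<^bsub>K\<^esub> xs ! Suc i) # drop (i + 2) xs))
     + (- 1) ^ Suc n * c (butlast xs))"

text \<open>Below, \<open>C\<close> is a subcomplex of the complex of all cochains of \<open>K\<close>.\<close>

definition cocycles ::
    "('a, 'm) monoid_scheme \<Rightarrow> (nat \<Rightarrow> ('a list \<Rightarrow> real) set) \<Rightarrow> nat \<Rightarrow> ('a list \<Rightarrow> real) set" where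
  "cocycles K C n = {c \<in> C n. coboundary K n c = (\<lambda>_. 0)}"

definition coboundaries ::
    "('a, 'm) monoid_scheme \<Rightarrow> (nat \<Rightarrow> ('a list \<Rightarrow> real) set) \<Rightarrow> nat \<Rightarrow> ('a list \<Rightarrow> real) set" where
  "coboundaries K C n = (case n of 0 \<Rightarrow> {\<lambda>_. 0} | Suc m \<Rightarrow> coboundary K m ` C m)"

definition complex_cohomology ::
    "('a, 'm) monoid_scheme \<Rightarrow> (nat \<Rightarrow> ('a list \<Rightarrow> real) set) \<Rightarrow> nat \<Rightarrow> ('a list \<Rightarrow> real) set monoid" where
  "complex_cohomology K C n = fun_space (cocycles K C n) Mod coboundaries K C n"

abbreviation cohomology ::
    "('a, 'm) monoid_scheme \<Rightarrow> nat \<Rightarrow> ('a list \<Rightarrow> real) set monoid" where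
  "cohomology K \<equiv> complex_cohomology K (cochains K)"

abbreviation bounded_cohomology ::
    "('a, 'm) monoid_scheme \<Rightarrow> nat \<Rightarrow> ('a list \<Rightarrow> real) set monoid" where
  "bounded_cohomology K \<equiv> complex_cohomology K (bounded_cochains K)"

definition cohomology_class ::
    "('a, 'm) monoid_scheme \<Rightarrow> nat \<Rightarrow> ('a list \<Rightarrow> real) \<Rightarrow> ('a list \<Rightarrow> real) set" where
  "cohomology_class K n z =
     coboundaries K (cochains K) n #>\<^bsub>fun_space (cocycles K (cochains K) n)\<^esub> z"

definition cochain_pullback ::
    "('a, 'm) monoid_scheme \<Rightarrow> ('a \<Rightarrow> 'b) \<Rightarrow> nat \<Rightarrow> ('b list \<Rightarrow> real) \<Rightarrow> 'a list \<Rightarrow> real" where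
  "cochain_pullback K \<phi> n c = restr (tuples K n) (\<lambda>xs. c (map \<phi> xs))"

text \<open>
  The map on cohomology induced by a homomorphism \<open>\<phi>\<close> with source \<open>K\<close>: all representatives
  of a class \<open>X\<close> have cohomologous pullbacks, and \<open>the_elem\<close> picks their common class.
\<close>

definition cohomology_pullback ::
    "('a, 'm) monoid_scheme \<Rightarrow> ('a \<Rightarrow> 'b) \<Rightarrow> nat \<Rightarrow> ('b list \<Rightarrow> real) set \<Rightarrow> ('a list \<Rightarrow> real) set" where
  "cohomology_pullback K \<phi> n X =
     the_elem ((\<lambda>z. cohomology_class K n (cochain_pullback K \<phi> n z)) ` X)"

definition normalized :: "('a, 'm) monoid_scheme \<Rightarrow> nat \<Rightarrow> ('a list \<Rightarrow> real) \<Rightarrow> bool" where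
  "normalized K n c \<longleftrightarrow> (\<forall>xs \<in> tuples K n. \<one>\<^bsub>K\<^esub> \<in> set xs \<longrightarrow> c xs = 0)"


section \<open>Homogeneous quasimorphisms\<close>

definition homogeneous_quasimorphisms :: "('a, 'm) monoid_scheme \<Rightarrow> ('a \<Rightarrow> real) set" where
  "homogeneous_quasimorphisms K = {\<mu>.
     (\<forall>g. g \<notin> carrier K \<longrightarrow> \<mu> g = 0) \<and>
     bdd_above {\<bar>\<mu> (g \<otimes>\<^bsub>K\<^esub> h) - \<mu> g - \<mu> h\<bar> | g h. g \<in> carrier K \<and> h \<in> carrier K} \<and>
     (\<forall>g \<in> carrier K. \<forall>n::int. \<mu> (g [^]\<^bsub>K\<^esub> n) = of_int n * \<mu> g)}"

definition conj_invariant :: "('a, 'm) monoid_scheme \<Rightarrow> 'a set \<Rightarrow> ('a \<Rightarrow> real) \<Rightarrow> bool" where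
  "conj_invariant G N \<mu> \<longleftrightarrow>
     (\<forall>g \<in> carrier G. \<forall>x \<in> N. \<mu> (g \<otimes>\<^bsub>G\<^esub> x \<otimes>\<^bsub>G\<^esub> inv\<^bsub>G\<^esub> g) = \<mu> x)"

definition invariant_quasimorphisms ::
    "('a, 'm) monoid_scheme \<Rightarrow> 'a set \<Rightarrow> ('a \<Rightarrow> real) set" where
  "invariant_quasimorphisms G N =
     {\<mu> \<in> homogeneous_quasimorphisms (G\<lparr>carrier := N\<rparr>). conj_invariant G N \<mu>}"

definition invariant_homs :: "('a, 'm) monoid_scheme \<Rightarrow> 'a set \<Rightarrow> ('a \<Rightarrow> real) set" where
  "invariant_homs G N = {\<phi>.
     (\<forall>x. x \<notin> N \<longrightarrow> \<phi> x = 0) \<and>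
     (\<forall>x \<in> N. \<forall>y \<in> N. \<phi> (x \<otimes>\<^bsub>G\<^esub> y) = \<phi> x + \<phi> y) \<and>
     conj_invariant G N \<phi>}"

definition W_denominator :: "('a, 'm) monoid_scheme \<Rightarrow> 'a set \<Rightarrow> ('a \<Rightarrow> real) set" where
  "W_denominator G N =
     invariant_homs G N <#>\<^bsub>fun_space (invariant_quasimorphisms G N)\<^esub>
     (restr N ` homogeneous_quasimorphisms G)"

definition W_space :: "('a, 'm) monoid_scheme \<Rightarrow> 'a set \<Rightarrow> ('a \<Rightarrow> real) set monoid" where
  "W_space G N = fun_space (invariant_quasimorphisms G N) Mod W_denominator G N"

definition W_class ::
    "('a, 'm) monoid_scheme \<Rightarrow> 'a set \<Rightarrow> ('a \<Rightarrow> real) \<Rightarrow> ('a \<Rightarrow> real) set" where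
  "W_class G N \<mu> = W_denominator G N #>\<^bsub>fun_space (invariant_quasimorphisms G N)\<^esub> \<mu>"


section \<open>The circle and its orientation preserving homeomorphisms\<close>

quotient_type circle = real / "\<lambda>x y. x - y \<in> \<int>"
  morphisms rep_circle circle_of
proof (rule equivpI)
  show "reflp (\<lambda>x y::real. x - y \<in> \<int>)"
    by (simp add: reflp_def)
  show "symp (\<lambda>x y::real. x - y \<in> \<int>)"
    by (metis (mono_tags, lifting) Ints_minus minus_diff_eq sympI)
  show "transp (\<lambda>x y::real. x - y \<in> \<int>)"
    by (rule transpI) (metis Ints_add diff_add_cancel add_diff_eq)
qed

text \<open>The quotient topology of \<open>\<real>/\<int>\<close>.\<close>

instantiation circle :: topological_space
begin

definition open_circle :: "circle set \<Rightarrow> bool" where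
  "open_circle U \<longleftrightarrow> open (circle_of -` U)"

instance
  by standard (auto simp: open_circle_def vimage_Union)

end

text \<open>
  A self-homeomorphism of the circle preserves the orientation iff it lifts to an increasing
  map of the real line.
\<close>

definition orientation_preserving :: "(circle \<Rightarrow> circle) \<Rightarrow> bool" where
  "orientation_preserving f \<longleftrightarrow>
     (\<exists>F :: real \<Rightarrow> real. continuous_on UNIV F \<and> strict_mono F \<and>
        (\<forall>x. circle_of (F x) = f (circle_of x)))"

definition Homeo_plus :: "(circle \<Rightarrow> circle) monoid" where
  "Homeo_plus = \<lparr>
     carrier = {f. (\<exists>g. homeomorphism UNIV UNIV f g) \<and> orientation_preserving f},
     monoid.mult = (\<circ>),
     one = id\<rparr>"

definition Homeo_tilde :: "(real \<Rightarrow> real) set" where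
  "Homeo_tilde = {F. (\<exists>F'. homeomorphism UNIV UNIV F F') \<and> (\<forall>x. F (x + 1) = F x + 1)}"

definition is_lift :: "(real \<Rightarrow> real) \<Rightarrow> (circle \<Rightarrow> circle) \<Rightarrow> bool" where
  "is_lift F f \<longleftrightarrow> F \<in> Homeo_tilde \<and> (\<forall>x. circle_of (F x) = f (circle_of x))"

definition translation_number :: "(real \<Rightarrow> real) \<Rightarrow> real" where
  "translation_number F = lim (\<lambda>n. (F ^^ n) 0 / real n)"


section \<open>The real Euler class\<close>

text \<open>
  Two lifts of the same homeomorphism differ by an integer translation, and
  \<open>translation_number\<close> changes by the same integer, so the choice of lifts is immaterial.
\<close>

definition some_lift :: "(circle \<Rightarrow> circle) \<Rightarrow> real \<Rightarrow> real" where
  "some_lift f = (SOME F. is_lift F f)"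

definition euler_cocycle :: "(circle \<Rightarrow> circle) list \<Rightarrow> real" where
  "euler_cocycle = restr (tuples Homeo_plus 2) (\<lambda>xs.
     let F = some_lift (xs ! 0); F' = some_lift (xs ! 1)
     in translation_number (F \<circ> F') - translation_number F - translation_number F')"

definition real_euler_class :: "((circle \<Rightarrow> circle) list \<Rightarrow> real) set" where
  "real_euler_class = cohomology_class Homeo_plus 2 euler_cocycle"

end

theory Submission imports Defs begin

text \<open>
  Suppose that \<open>\<nu>\<close>, the restriction of \<open>u\<close> to \<open>N\<close>, is the sum of an invariant homomorphism
  \<open>\<phi>\<close> and the restriction of a homogeneous quasimorphism \<open>\<mu>\<close> on \<open>G\<close>. Replacing \<open>u\<close> by
  \<open>u - \<mu>\<close> changes \<open>\<rho>\<^sup>* \<chi>\<^sub>b = p\<^sup>* A + \<delta>u\<close> only by the bounded cochain \<open>\<delta>\<mu>\<close>, so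
  \<open>p\<^sup>* A + \<delta>(u - \<mu>)\<close> is bounded and \<open>u - \<mu>\<close> is the homomorphism \<open>\<phi>\<close> on \<open>N\<close>. An
  invariant homomorphism extends to a function \<open>w\<close> on \<open>G\<close> whose coboundary comes from the
  quotient \<open>\<Gamma>\<close> (\<open>invariant_hom_extension\<close>), and \<open>u - \<mu> - w\<close> varies boundedly along the
  cosets of \<open>N\<close>, so that it comes from \<open>\<Gamma>\<close> up to a bounded error. Therefore \<open>A\<close> differs
  from a bounded cocycle on \<open>\<Gamma>\<close> by cochains whose pullbacks to \<open>G\<close> are coboundaries. If
  the second bounded cohomology of \<open>\<Gamma>\<close> vanishes, the bounded cocycle is a coboundary too.
  Hence \<open>p\<^sup>* A\<close> and \<open>\<rho>\<^sup>* \<chi>\<^sub>b\<close> are coboundaries and the pulled back Euler class is zero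
  (\<open>inflated_cocycle_trivial\<close>, \<open>euler_class_trivial_if_decomposes\<close>). Extendability of
  \<open>\<nu>\<close> is the case \<open>\<phi> = 0\<close>.

  That \<open>\<nu>\<close> is an invariant homogeneous quasimorphism rests on three properties of the Euler
  cocycle, applied to the equation \<open>u (x g) = u x + u g - \<chi>\<^sub>b (\<rho> x, \<rho> g)\<close> for \<open>x\<close> in \<open>N\<close>.
  It is bounded, because the translation number is a quasimorphism. It vanishes on commuting
  pairs, because commuting circle homeomorphisms have commuting lifts; so \<open>u\<close> is additive on
  commuting elements of \<open>N\<close>, which implies homogeneity. And
  \<open>\<chi>\<^sub>b (f g f\<^sup>-\<^sup>1, f) = \<chi>\<^sub>b (f, g)\<close>, because the translation number is invariant under
  conjugation; this gives the invariance of \<open>\<nu>\<close>.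
\<close>

section \<open>The translation number\<close>

text \<open>
  A class of maps closed under composition that contains every lift of an orientation preserving
  circle homeomorphism (see \<open>Homeo_tilde_degree_one\<close>) and has the displacement bound below.
\<close>

definition degree_one :: "(real \<Rightarrow> real) \<Rightarrow> bool" where
  "degree_one F \<longleftrightarrow> mono F \<and> (\<forall>x. F (x + 1) = F x + 1)"

lemma shift_of_nat:
  fixes F :: "real \<Rightarrow> real"
  assumes "\<And>x. F (x + 1) = F x + 1"
  shows "F (x + of_nat n) = F x + of_nat n"
proof (induction n)
  case (Suc n)
  then show ?case
    using assms[of "x + of_nat n"] by (simp add: algebra_simps)
qed simp

lemma shift_of_int:
  fixes F :: "real \<Rightarrow> real"
  assumes "\<And>x. F (x + 1) = F x + 1"
  shows "F (x + of_int k) = F x + of_int k"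
proof (cases "k \<ge> 0")
  case True
  then show ?thesis
    using shift_of_nat[of F x "nat k", OF assms] by simp
next
  case False
  then show ?thesis
    using shift_of_nat[of F "x + of_int k" "nat (- k)", OF assms] by simp
qed

text \<open>
  The displacement \<open>x \<mapsto> F x - x\<close> is periodic, and monotonicity confines its oscillation over
  one period. Every estimate on translation numbers below is an instance of this bound.
\<close>

lemma degree_one_displacement:
  assumes "degree_one F"
  shows "\<bar>F x - x - F 0\<bar> \<le> 1"
proof -
  have F: "mono F" "\<And>x. F (x + 1) = F x + 1"
    using assms by (auto simp: degree_one_def)
  have "F x = F (frac x) + of_int \<lfloor>x\<rfloor>"
    using shift_of_int[of F "frac x" "\<lfloor>x\<rfloor>", OF F(2)] by (simp add: frac_def)
  moreover have "F 0 \<le> F (frac x)" "F (frac x) \<le> F 1"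
    using F(1) frac_lt_1[of x] by (auto intro!: monoD[of F])
  moreover have "F 1 = F 0 + 1"
    using F(2)[of 0] by simp
  ultimately show ?thesis
    using frac_ge_0[of x] frac_lt_1[of x] by (simp add: frac_def) linarith
qed

lemma degree_one_comp: "degree_one F \<Longrightarrow> degree_one G \<Longrightarrow> degree_one (F \<circ> G)"
  by (simp add: degree_one_def mono_def)

lemma degree_one_funpow: "degree_one F \<Longrightarrow> degree_one (F ^^ n)"
  by (induction n) (auto intro: degree_one_comp simp: degree_one_def[of id] mono_def)

text \<open>
  The translation number is recognized as the only rate of growth from which the orbit of
  \<open>0\<close> has bounded deviation. Together with \<open>translation_number_orbit\<close> this replaces all
  manipulations of limits in the algebraic properties below.
\<close>

lemma translation_number_unique:
  assumes "\<And>n. \<bar>(F ^^ n) 0 - real n * t\<bar> \<le> C"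
  shows "translation_number F = t"
proof -
  have "(\<lambda>n. (F ^^ n) 0 / real n - t) \<longlonglongrightarrow> 0"
  proof (rule tendsto_rabs_zero_cancel, rule tendsto_sandwich[where f = "\<lambda>_. 0"])
    show "\<forall>\<^sub>F n in sequentially. \<bar>(F ^^ n) 0 / real n - t\<bar> \<le> C / real n"
      using eventually_gt_at_top[of "0::nat"]
    proof eventually_elim
      case (elim n)
      then have "(F ^^ n) 0 / real n - t = ((F ^^ n) 0 - real n * t) / real n"
        by (simp add: field_simps)
      then show ?case
        using assms[of n] elim by (simp add: abs_divide divide_right_mono)
    qed
    show "(\<lambda>n. C / real n) \<longlonglongrightarrow> 0"
      by (rule lim_const_over_n)
  qed auto
  then show ?thesis
    unfolding translation_number_def by (intro limI) (simp add: LIM_zero_iff)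
qed

text \<open>
  By the displacement bound the orbit \<open>a n = (F ^^ n) 0\<close> is additive up to an error \<open>1\<close>, hence
  \<open>a (m * n)\<close> is within \<open>m\<close> of \<open>m * a n\<close>. Comparing \<open>a (m * n)\<close> with both \<open>m * a n\<close> and
  \<open>n * a m\<close> shows that \<open>a n / n\<close> is a Cauchy sequence, and the same comparison gives the rate
  of convergence.
\<close>

lemma translation_number_orbit:
  assumes F: "degree_one F"
  shows "\<bar>(F ^^ n) 0 - real n * translation_number F\<bar> \<le> 1"
proof -
  define a where "a n = (F ^^ n) 0" for n
  have add: "\<bar>a (m + n) - a m - a n\<bar> \<le> 1" for m n
    using degree_one_displacement[OF degree_one_funpow[OF F, of m], of "a n"]
    by (simp add: a_def funpow_add)
  have mult: "\<bar>a (m * n) - real m * a n\<bar> \<le> real m" for m n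
  proof (induction m)
    case (Suc m)
    then show ?case
      using add[of n "m * n"] by (simp add: algebra_simps)
  qed (simp add: a_def)
  have cross: "\<bar>real n * a m - real m * a n\<bar> \<le> real m + real n" for m n
    using mult[of m n] mult[of n m] by (simp add: mult.commute)
  have close: "\<bar>a m / real m - a n / real n\<bar> \<le> 1 / real n + 1 / real m" if "m > 0" "n > 0" for m n
  proof -
    have "a m / real m - a n / real n = (real n * a m - real m * a n) / (real m * real n)"
      using that by (simp add: field_simps)
    also have "\<bar>\<dots>\<bar> \<le> (real m + real n) / (real m * real n)"
      using cross[of m n] that by (simp add: abs_divide abs_mult divide_right_mono)
    also have "\<dots> = 1 / real n + 1 / real m"
      using that by (simp add: field_simps)
    finally show ?thesis .
  qed
  have "Cauchy (\<lambda>n. a n / real n)"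
  proof (rule metric_CauchyI)
    fix e :: real assume "e > 0"
    then obtain M :: nat where M: "1 / (e / 2) < real M"
      using reals_Archimedean2 by blast
    have M0: "real M > 0"
      using M \<open>e > 0\<close> by (smt (verit) divide_pos_pos)
    have small: "1 / real n < e / 2" if "n \<ge> M" for n
    proof -
      have "1 / real n \<le> 1 / real M"
        using that M0 by (intro divide_left_mono) auto
      also have "\<dots> < e / 2"
        using M M0 \<open>e > 0\<close> by (simp add: field_simps)
      finally show ?thesis .
    qed
    show "\<exists>M. \<forall>m\<ge>M. \<forall>n\<ge>M. dist (a m / real m) (a n / real n) < e"
    proof (intro exI[of _ M] allI impI)
      fix m n assume "m \<ge> M" "n \<ge> M"
      then show "dist (a m / real m) (a n / real n) < e"
        using close[of m n] small[of m] small[of n] M0 by (simp add: dist_real_def)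
    qed
  qed
  then have lim: "(\<lambda>m. a m / real m) \<longlonglongrightarrow> translation_number F"
    unfolding translation_number_def a_def by (simp add: Cauchy_convergent_iff convergent_LIMSEQ_iff)
  show ?thesis
  proof (cases "n = 0")
    case False
    have "\<bar>translation_number F - a n / real n\<bar> \<le> 1 / real n + 0"
    proof (rule tendsto_le)
      show "(\<lambda>m. \<bar>a m / real m - a n / real n\<bar>) \<longlonglongrightarrow> \<bar>translation_number F - a n / real n\<bar>"
        by (intro tendsto_intros lim)
      show "(\<lambda>m. 1 / real n + 1 / real m) \<longlonglongrightarrow> 1 / real n + 0"
        by (intro tendsto_intros lim_const_over_n)
      show "\<forall>\<^sub>F m in sequentially. \<bar>a m / real m - a n / real n\<bar> \<le> 1 / real n + 1 / real m"
        using eventually_gt_at_top[of "0::nat"] by eventually_elim (use close False in auto)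
    qed simp
    then have "real n * \<bar>translation_number F - a n / real n\<bar> \<le> 1"
      using False by (simp add: field_simps)
    moreover have "real n * \<bar>translation_number F - a n / real n\<bar> = \<bar>real n * (translation_number F - a n / real n)\<bar>"
      by (simp add: abs_mult)
    moreover have "real n * (translation_number F - a n / real n) = real n * translation_number F - a n"
      using False by (simp add: field_simps)
    ultimately show ?thesis
      by (simp add: a_def abs_minus_commute)
  qed (simp add: a_def)
qed

lemma translation_number_approx:
  "degree_one F \<Longrightarrow> \<bar>F 0 - translation_number F\<bar> \<le> 1"
  using translation_number_orbit[of F 1] by simp

lemma translation_number_defect:
  assumes F: "degree_one F" and G: "degree_one G"
  shows "\<bar>translation_number (F \<circ> G) - translation_number F - translation_number G\<bar> \<le> 4"
proof -
  have "\<bar>F (G 0) - G 0 - F 0\<bar> \<le> 1"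
    using degree_one_displacement[OF F] .
  then show ?thesis
    using translation_number_approx[OF F] translation_number_approx[OF G]
      translation_number_approx[OF degree_one_comp[OF F G]] by simp
qed

text \<open>
  For commuting maps \<open>(F \<circ> G) ^^ n = (F ^^ n) \<circ> (G ^^ n)\<close>, so the orbit of the composite is
  the sum of the two orbits up to one displacement error.
\<close>

lemma translation_number_comp_commuting:
  assumes F: "degree_one F" and G: "degree_one G" and comm: "F \<circ> G = G \<circ> F"
  shows "translation_number (F \<circ> G) = translation_number F + translation_number G"
proof (rule translation_number_unique[where C = 3])
  fix n
  have pow: "((F \<circ> G) ^^ n) = (F ^^ n) \<circ> (G ^^ n)"
  proof (induction n)
    case (Suc n)
    have "G \<circ> (F ^^ n) = (F ^^ n) \<circ> G"
      by (induction n) (use comm[symmetric] in \<open>simp_all add: fun_eq_iff\<close>)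
    then show ?case
      using Suc by (simp add: fun_eq_iff)
  qed simp
  have "\<bar>(F ^^ n) ((G ^^ n) 0) - (G ^^ n) 0 - (F ^^ n) 0\<bar> \<le> 1"
    by (rule degree_one_displacement[OF degree_one_funpow[OF F]])
  then show "\<bar>((F \<circ> G) ^^ n) 0 - real n * (translation_number F + translation_number G)\<bar> \<le> 3"
    using translation_number_orbit[OF F, of n] translation_number_orbit[OF G, of n]
    by (simp add: pow algebra_simps)
qed

lemma translation_number_plus_int:
  assumes F: "degree_one F"
  shows "translation_number (\<lambda>x. F x + of_int k) = translation_number F + of_int k"
proof (rule translation_number_unique[where C = 1])
  fix n
  have "F (x + real n * of_int k) = F x + real n * of_int k" for x n
    using shift_of_int[of F x "int n * k"] F by (simp add: degree_one_def)
  then have "((\<lambda>x. F x + of_int k) ^^ n) 0 = (F ^^ n) 0 + real n * of_int k"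
    by (induction n) (simp_all add: distrib_right)
  then show "\<bar>((\<lambda>x. F x + of_int k) ^^ n) 0 - real n * (translation_number F + of_int k)\<bar> \<le> 1"
    using translation_number_orbit[OF F, of n] by (simp add: algebra_simps)
qed

text \<open>
  Powers of the conjugate are conjugates of powers, and conjugation by a fixed map changes an
  orbit only by a bounded amount.
\<close>

lemma translation_number_conjugate:
  assumes F: "degree_one F" and G: "degree_one G" and inv: "G \<circ> G' = id" "G' \<circ> G = id"
  shows "translation_number (G \<circ> F \<circ> G') = translation_number F"
proof (rule translation_number_unique)
  fix n
  have "(G \<circ> F \<circ> G') ^^ n = G \<circ> (F ^^ n) \<circ> G'"
    using inv by (induction n) (simp_all add: fun_eq_iff)
  moreover have "\<bar>G ((F ^^ n) (G' 0)) - (F ^^ n) (G' 0) - G 0\<bar> \<le> 1"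
    by (rule degree_one_displacement[OF G])
  moreover have "\<bar>(F ^^ n) (G' 0) - G' 0 - (F ^^ n) 0\<bar> \<le> 1"
    by (rule degree_one_displacement[OF degree_one_funpow[OF F]])
  ultimately show "\<bar>((G \<circ> F \<circ> G') ^^ n) 0 - real n * translation_number F\<bar> \<le> \<bar>G 0\<bar> + \<bar>G' 0\<bar> + 3"
    using translation_number_orbit[OF F, of n] by simp
qed

section \<open>Lifts of circle homeomorphisms\<close>

lemma circle_of_eq_iff: "circle_of x = circle_of y \<longleftrightarrow> x - y \<in> \<int>"
  using circle.abs_eq_iff .

text \<open>
  The ambiguity in choosing lifts is measured by continuous functions with integer values.
\<close>

lemma Ints_valued_continuous_constant:
  fixes h :: "real \<Rightarrow> real"
  assumes cont: "continuous_on UNIV h" and int: "\<And>x. h x \<in> \<int>"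
  obtains k :: int where "\<And>x. h x = of_int k"
proof -
  have "h constant_on UNIV"
  proof (rule continuous_discrete_range_constant[OF _ cont])
    fix x
    have "1 \<le> norm (h y - h x)" if "h y \<noteq> h x" for y
      using Ints_nonzero_abs_ge1[of "h y - h x"] int[of x] int[of y] that by simp
    then show "\<exists>e>0. \<forall>y. y \<in> UNIV \<and> h y \<noteq> h x \<longrightarrow> e \<le> norm (h y - h x)"
      by (intro exI[of _ 1]) auto
  qed simp
  then obtain c where c: "\<And>x. h x = c"
    by (auto simp: constant_on_def)
  moreover obtain k :: int where "c = of_int k"
    using int[of 0] c by (auto elim: Ints_cases)
  ultimately show thesis
    using that by metis
qed

text \<open>
  A homeomorphism of the line is injective and continuous, hence strictly monotone;
  \<open>F (x + n) = F x + n\<close> excludes that it decreases.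
\<close>

lemma Homeo_tilde_degree_one:
  assumes "F \<in> Homeo_tilde"
  shows "degree_one F"
proof -
  obtain F' where hom: "homeomorphism UNIV UNIV F F'" and shift: "\<And>x. F (x + 1) = F x + 1"
    using assms by (auto simp: Homeo_tilde_def)
  have cont: "continuous_on A F" and inj: "inj_on F A" for A
    using hom by (auto simp: homeomorphism_def intro: continuous_on_subset inj_on_inverseI)
  have "F x < F y" if "x < y" for x y
  proof -
    obtain n :: nat where "y - x < real n"
      using reals_Archimedean2 by blast
    then show ?thesis
      using continuous_inj_imp_mono[of x y "x + real n" F] cont inj that shift_of_nat[of F x n, OF shift]
      by auto
  qed
  then show ?thesis
    unfolding degree_one_def using shift by (auto intro: strict_mono_mono strict_monoI)
qed

lemma Homeo_tilde_comp:
  assumes "F \<in> Homeo_tilde" "G \<in> Homeo_tilde"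
  shows "F \<circ> G \<in> Homeo_tilde"
  using assms unfolding Homeo_tilde_def by (auto intro: homeomorphism_compose)

lemma Homeo_tilde_inverse:
  assumes "F \<in> Homeo_tilde"
  obtains F' where "F' \<in> Homeo_tilde" "F \<circ> F' = id" "F' \<circ> F = id"
proof -
  obtain F' where hom: "homeomorphism UNIV UNIV F F'" and shift: "\<And>x. F (x + 1) = F x + 1"
    using assms by (auto simp: Homeo_tilde_def)
  have inv: "F (F' x) = x" "F' (F x) = x" for x
    using hom by (auto simp: homeomorphism_def)
  have "F' (x + 1) = F' x + 1" for x
    using inv shift[of "F' x"] by metis
  then show thesis
    using that[of F'] homeomorphism_symD[OF hom] inv by (auto simp: Homeo_tilde_def fun_eq_iff)
qed

lemma is_lift_unique:
  assumes F: "is_lift F f" and G: "is_lift G f"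
  obtains k :: int where "F = (\<lambda>x. G x + of_int k)"
proof -
  have "continuous_on UNIV F" "continuous_on UNIV G"
    using F G by (auto simp: is_lift_def Homeo_tilde_def homeomorphism_def)
  then have "continuous_on UNIV (\<lambda>x. F x - G x)"
    by (intro continuous_intros)
  moreover have "F x - G x \<in> \<int>" for x
    using F G circle_of_eq_iff[of "F x" "G x"] by (simp add: is_lift_def)
  ultimately obtain k :: int where "\<And>x. F x - G x = of_int k"
    using Ints_valued_continuous_constant by blast
  then show thesis
    by (intro that[of k]) (auto simp: fun_eq_iff algebra_simps)
qed

lemma is_lift_translation_number:
  assumes "is_lift F f" "is_lift G f"
  obtains k :: int where "F = (\<lambda>x. G x + of_int k)"
    "translation_number F = translation_number G + of_int k"
proof -
  obtain k :: int where "F = (\<lambda>x. G x + of_int k)"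
    using is_lift_unique[OF assms] .
  moreover have "degree_one G"
    using assms(2) by (simp add: is_lift_def Homeo_tilde_degree_one)
  ultimately show thesis
    using that translation_number_plus_int by simp
qed

text \<open>
  Let \<open>F\<close> be an increasing continuous map of the line over \<open>f\<close>. Then \<open>F (x + 1) - F x\<close> is an
  integer depending continuously on \<open>x\<close>, hence a constant \<open>k > 0\<close>. If \<open>k\<close> were at least \<open>2\<close>,
  some point strictly between \<open>0\<close> and \<open>1\<close> would be sent to \<open>F 0 + 1\<close>, contradicting
  injectivity of \<open>f\<close>. So \<open>k = 1\<close>, which also makes \<open>F\<close> unbounded in both directions and therefore onto.
\<close>

lemma Homeo_plus_has_lift:
  assumes "f \<in> carrier Homeo_plus"
  obtains F where "is_lift F f"
proof -
  obtain F :: "real \<Rightarrow> real" and f' where cont: "continuous_on UNIV F" and mono: "strict_mono F"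
    and lift: "\<And>x. circle_of (F x) = f (circle_of x)" and f': "homeomorphism UNIV UNIV f f'"
    using assms by (auto simp: Homeo_plus_def orientation_preserving_def)
  have "F (x + 1) - F x \<in> \<int>" for x
    using circle_of_eq_iff[of "F (x + 1)" "F x"] circle_of_eq_iff[of "x + 1" x] lift by simp
  moreover have "continuous_on UNIV (\<lambda>x. F (x + 1) - F x)"
    by (intro continuous_intros continuous_on_compose2[OF cont]) auto
  ultimately obtain k :: int where k: "\<And>x. F (x + 1) - F x = of_int k"
    using Ints_valued_continuous_constant[of "\<lambda>x. F (x + 1) - F x"] by blast
  have "k > 0"
    using k[of 0] strict_monoD[OF mono, of 0 1] by simp
  moreover have "k < 2"
  proof (rule ccontr)
    assume "\<not> k < 2"
    then have "F 0 + 1 < F 1"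
      using k[of 0] by simp
    then obtain y where y: "0 \<le> y" "y \<le> 1" "F y = F 0 + 1"
      using IVT'[of F 0 "F 0 + 1" 1] continuous_on_subset[OF cont, of "{0..1}"] by auto
    have "f (circle_of y) = f (circle_of 0)"
      using y(3) circle_of_eq_iff[of "F y" "F 0"] by (simp flip: lift)
    then have "circle_of y = circle_of 0"
      using f' by (metis UNIV_I homeomorphism_apply1)
    then have "y \<in> \<int>"
      using circle_of_eq_iff[of y 0] by simp
    then have "y = 0 \<or> y = 1"
      using y by (auto elim!: Ints_cases)
    then show False
      using y \<open>F 0 + 1 < F 1\<close> by auto
  qed
  ultimately have "k = 1"
    by simp
  then have shift: "F (x + 1) = F x + 1" for x
    using k[of x] by simp
  have "\<exists>x. F x = y" for y
  proof -
    obtain n :: nat where n: "\<bar>y - F 0\<bar> < real n"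
      using reals_Archimedean2 by blast
    have "F (real n) = F 0 + real n" "F (- real n) = F 0 - real n"
      using shift_of_nat[of F 0 n, OF shift] shift_of_nat[of F "- real n" n, OF shift] by auto
    then show ?thesis
      using IVT'[of F "- real n" y "real n"] n continuous_on_subset[OF cont, of "{- real n..real n}"]
      by (auto simp: abs_less_iff)
  qed
  then have "range F = UNIV"
    by (metis surjI surj_def)
  then obtain F' where "homeomorphism UNIV UNIV F F'"
    using homeomorphism_into_1d[of UNIV F UNIV] cont strict_mono_imp_inj_on[OF mono] by auto
  then show thesis
    using that[of F] shift lift by (auto simp: is_lift_def Homeo_tilde_def)
qed

lemma some_lift_is_lift: "f \<in> carrier Homeo_plus \<Longrightarrow> is_lift (some_lift f) f"
  unfolding some_lift_def by (metis Homeo_plus_has_lift someI_ex)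

section \<open>The Euler cocycle\<close>

lemma euler_cocycle_lifts:
  assumes f: "f \<in> carrier Homeo_plus" and g: "g \<in> carrier Homeo_plus"
    and F: "is_lift F f" and G: "is_lift G g"
  shows "euler_cocycle [f, g] = translation_number (F \<circ> G) - translation_number F - translation_number G"
proof -
  obtain k where k: "some_lift f = (\<lambda>x. F x + of_int k)"
    "translation_number (some_lift f) = translation_number F + of_int k"
    using is_lift_translation_number[OF some_lift_is_lift[OF f] F] .
  obtain l where l: "some_lift g = (\<lambda>x. G x + of_int l)"
    "translation_number (some_lift g) = translation_number G + of_int l"
    using is_lift_translation_number[OF some_lift_is_lift[OF g] G] .
  have "F (x + of_int l) = F x + of_int l" for x
    using F Homeo_tilde_degree_one shift_of_int[of F] by (auto simp: is_lift_def degree_one_def)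
  then have "some_lift f \<circ> some_lift g = (\<lambda>x. (F \<circ> G) x + of_int (k + l))"
    by (simp add: k(1) l(1) fun_eq_iff)
  moreover have "degree_one (F \<circ> G)"
    using F G by (simp add: is_lift_def Homeo_tilde_degree_one degree_one_comp)
  ultimately have "translation_number (some_lift f \<circ> some_lift g)
      = translation_number (F \<circ> G) + of_int (k + l)"
    by (simp only: translation_number_plus_int)
  then show ?thesis
    using f g k(2) l(2) by (simp add: euler_cocycle_def restr_def tuples_def Let_def)
qed

lemma euler_cocycle_bounded:
  assumes f: "f \<in> carrier Homeo_plus" and g: "g \<in> carrier Homeo_plus"
  shows "\<bar>euler_cocycle [f, g]\<bar> \<le> 4"
  using euler_cocycle_lifts[OF f g some_lift_is_lift[OF f] some_lift_is_lift[OF g]]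
    translation_number_defect[of "some_lift f" "some_lift g"]
    some_lift_is_lift[OF f] some_lift_is_lift[OF g]
  by (simp add: is_lift_def Homeo_tilde_degree_one)

text \<open>
  If \<open>h\<close> is the conjugate of \<open>g\<close> by \<open>f\<close>, conjugating a lift of \<open>g\<close> by a lift of \<open>f\<close>
  gives a lift of \<open>h\<close> with the translation number of the lift of \<open>g\<close>.
\<close>

lemma conjugate_lift:
  assumes h: "h \<circ> f = f \<circ> g" and F: "is_lift F f" and G: "is_lift G g"
  obtains H where "is_lift H h" "H \<circ> F = F \<circ> G" "translation_number H = translation_number G"
proof -
  obtain F' where F': "F' \<in> Homeo_tilde" "F \<circ> F' = id" "F' \<circ> F = id"
    using Homeo_tilde_inverse F by (auto simp: is_lift_def)
  define H where "H = F \<circ> G \<circ> F'"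
  have "circle_of (H x) = h (circle_of x)" for x
  proof -
    have "circle_of (H x) = (f \<circ> g) (circle_of (F' x))"
      using F G by (simp add: H_def is_lift_def)
    also have "\<dots> = h (circle_of (F (F' x)))"
      using F by (simp add: is_lift_def flip: h)
    also have "F (F' x) = x"
      using F'(2) by (simp add: fun_eq_iff)
    finally show ?thesis .
  qed
  then have "is_lift H h"
    using F G F'(1) by (simp add: H_def is_lift_def Homeo_tilde_comp)
  moreover have "H \<circ> F = F \<circ> G"
    using F'(3) by (simp add: H_def comp_assoc)
  moreover have "translation_number H = translation_number G"
    unfolding H_def using F G F' 
    by (intro translation_number_conjugate) (auto simp: is_lift_def Homeo_tilde_degree_one)
  ultimately show thesis
    using that by blast
qed

text \<open>
  This identity is what makes the primitive \<open>u\<close> invariant under conjugation on the normal subgroup.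
\<close>

lemma euler_cocycle_conjugate:
  assumes "f \<in> carrier Homeo_plus" "g \<in> carrier Homeo_plus" "h \<in> carrier Homeo_plus"
    and "h \<circ> f = f \<circ> g"
  shows "euler_cocycle [h, f] = euler_cocycle [f, g]"
proof -
  obtain F G where FG: "is_lift F f" "is_lift G g"
    using assms Homeo_plus_has_lift by metis
  obtain H where "is_lift H h" "H \<circ> F = F \<circ> G" "translation_number H = translation_number G"
    using conjugate_lift[OF assms(4) FG] .
  then show ?thesis
    using euler_cocycle_lifts assms FG by simp
qed

text \<open>
  Commuting circle homeomorphisms have commuting lifts: conjugating the lift \<open>G\<close> of \<open>g\<close> by a lift
  of \<open>f\<close> gives again a lift of \<open>g\<close>, that is, \<open>G\<close> plus an integer, and this integer is \<open>0\<close>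
  because both maps have the same translation number. On commuting lifts the translation number
  is additive. This identity is what makes \<open>u\<close> homogeneous on the normal subgroup.
\<close>

lemma euler_cocycle_commuting:
  assumes f: "f \<in> carrier Homeo_plus" and g: "g \<in> carrier Homeo_plus" and comm: "f \<circ> g = g \<circ> f"
  shows "euler_cocycle [f, g] = 0"
proof -
  obtain F G where FG: "is_lift F f" "is_lift G g"
    using f g Homeo_plus_has_lift by metis
  obtain H where H: "is_lift H g" "H \<circ> F = F \<circ> G" "translation_number H = translation_number G"
    using conjugate_lift[OF comm[symmetric] FG] .
  obtain k where k: "H = (\<lambda>x. G x + of_int k)"
    "translation_number H = translation_number G + of_int k"
    using is_lift_translation_number[OF H(1) FG(2)] .
  have "H = G"
    using k H(3) by simp
  then have "translation_number (F \<circ> G) = translation_number F + translation_number G"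
    using FG H(2)
    by (intro translation_number_comp_commuting) (auto simp: is_lift_def Homeo_tilde_degree_one)
  then show ?thesis
    using euler_cocycle_lifts[OF f g FG] by simp
qed

section \<open>Cochains and pullbacks\<close>

lemma tuples_1E:
  assumes "xs \<in> tuples K 1"
  obtains g where "g \<in> carrier K" "xs = [g]"
  using assms by (auto simp: tuples_def length_Suc_conv)

lemma tuples_2E:
  assumes "xs \<in> tuples K 2"
  obtains g h where "g \<in> carrier K" "h \<in> carrier K" "xs = [g, h]"
  using assms by (auto simp: tuples_def numeral_2_eq_2 length_Suc_conv)

lemma tuples_3E:
  assumes "xs \<in> tuples K 3"
  obtains g h k where "g \<in> carrier K" "h \<in> carrier K" "k \<in> carrier K" "xs = [g, h, k]"
  using assms by (auto simp: tuples_def numeral_3_eq_3 length_Suc_conv)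

lemma singleton_in_tuples [simp]: "[g] \<in> tuples K 1 \<longleftrightarrow> g \<in> carrier K"
  by (simp add: tuples_def)

lemma pair_in_tuples [simp]: "[g, h] \<in> tuples K 2 \<longleftrightarrow> g \<in> carrier K \<and> h \<in> carrier K"
  by (simp add: tuples_def)

lemma cochains_eqI:
  assumes "c \<in> cochains K n" "d \<in> cochains K n" "\<And>xs. xs \<in> tuples K n \<Longrightarrow> c xs = d xs"
  shows "c = d"
proof
  show "c xs = d xs" for xs
    using assms by (cases "xs \<in> tuples K n") (auto simp: cochains_def)
qed

lemma restr_in_cochains: "restr (tuples K n) f \<in> cochains K n"
  by (simp add: cochains_def restr_def)

lemma cochains_zero: "(\<lambda>_. 0) \<in> cochains K n"
  by (simp add: cochains_def)

lemma cochains_add: "c \<in> cochains K n \<Longrightarrow> d \<in> cochains K n \<Longrightarrow> (\<lambda>xs. c xs + d xs) \<in> cochains K n"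
  by (simp add: cochains_def)

lemma cochains_diff: "c \<in> cochains K n \<Longrightarrow> d \<in> cochains K n \<Longrightarrow> (\<lambda>xs. c xs - d xs) \<in> cochains K n"
  by (simp add: cochains_def)

lemma coboundary_in_cochains: "coboundary K n c \<in> cochains K (Suc n)"
  unfolding coboundary_def by (rule restr_in_cochains)

lemma coboundary_1_in_cochains: "coboundary K 1 c \<in> cochains K 2"
  using coboundary_in_cochains[of K 1 c] by (simp add: numeral_2_eq_2)

lemma coboundary_1:
  assumes "g \<in> carrier K" "h \<in> carrier K"
  shows "coboundary K 1 c [g, h] = c [h] - c [g \<otimes>\<^bsub>K\<^esub> h] + c [g]"
  using assms by (simp add: coboundary_def restr_def tuples_def)

lemma coboundary_2:
  assumes "g \<in> carrier K" "h \<in> carrier K" "k \<in> carrier K"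
  shows "coboundary K 2 c [g, h, k]
    = c [h, k] - c [g \<otimes>\<^bsub>K\<^esub> h, k] + c [g, h \<otimes>\<^bsub>K\<^esub> k] - c [g, h]"
  using assms by (simp add: coboundary_def restr_def tuples_def numeral_2_eq_2)

lemma coboundary_add:
  "coboundary K n (\<lambda>xs. c xs + d xs) = (\<lambda>xs. coboundary K n c xs + coboundary K n d xs)"
  by (simp add: fun_eq_iff coboundary_def restr_def distrib_left sum.distrib sum_subtractf sum_negf)

lemma coboundary_diff:
  "coboundary K n (\<lambda>xs. c xs - d xs) = (\<lambda>xs. coboundary K n c xs - coboundary K n d xs)"
  by (simp add: fun_eq_iff coboundary_def restr_def right_diff_distrib sum_subtractf sum_negf)

lemma coboundary_zero: "coboundary K n (\<lambda>_. 0) = (\<lambda>_. 0)"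
  using coboundary_diff[of K n "\<lambda>_. 0" "\<lambda>_. 0"] by simp

lemma (in monoid) coboundary_coboundary_1:
  "coboundary G 2 (coboundary G 1 c) = (\<lambda>_. 0)"
proof (rule cochains_eqI[of _ _ 3])
  show "coboundary G 2 (coboundary G 1 c) \<in> cochains G 3"
    using coboundary_in_cochains[of G 2] by simp
  fix xs assume "xs \<in> tuples G 3"
  then show "coboundary G 2 (coboundary G 1 c) xs = 0"
    by (auto elim!: tuples_3E simp: coboundary_1 coboundary_2 m_assoc simp del: One_nat_def)
qed (rule cochains_zero)

lemma cochain_pullback_in_cochains: "cochain_pullback K \<phi> n c \<in> cochains K n"
  unfolding cochain_pullback_def by (rule restr_in_cochains)

lemma cochain_pullback_apply: "xs \<in> tuples K n \<Longrightarrow> cochain_pullback K \<phi> n c xs = c (map \<phi> xs)"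
  by (simp add: cochain_pullback_def restr_def)

lemma cochain_pullback_add:
  "cochain_pullback K \<phi> n (\<lambda>xs. c xs + d xs)
    = (\<lambda>xs. cochain_pullback K \<phi> n c xs + cochain_pullback K \<phi> n d xs)"
  by (simp add: fun_eq_iff cochain_pullback_def restr_def)

lemma cochain_pullback_zero: "cochain_pullback K \<phi> n (\<lambda>_. 0) = (\<lambda>_. 0)"
  by (simp add: fun_eq_iff cochain_pullback_def restr_def)

lemma (in monoid) cochain_pullback_coboundary:
  assumes \<phi>: "\<phi> \<in> hom G L"
  shows "cochain_pullback G \<phi> (Suc n) (coboundary L n c) = coboundary G n (cochain_pullback G \<phi> n c)"
proof (rule cochains_eqI[OF cochain_pullback_in_cochains coboundary_in_cochains])
  fix xs assume xs: "xs \<in> tuples G (Suc n)"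
  then have len: "length xs = Suc n" and carr: "set xs \<subseteq> carrier G"
    by (auto simp: tuples_def)
  have image: "map \<phi> xs \<in> tuples L (Suc n)"
    using \<phi> len carr by (auto simp: tuples_def hom_def)
  have outer: "tl xs \<in> tuples G n" "butlast xs \<in> tuples G n"
    using len carr by (auto simp: tuples_def dest: in_set_butlastD list.set_sel(2)[rotated])
  have inner: "take i xs @ (xs ! i \<otimes> xs ! Suc i) # drop (i + 2) xs \<in> tuples G n" if "i < n" for i
    using that len carr nth_mem[of i xs] nth_mem[of "Suc i" xs]
    by (auto simp: tuples_def subset_iff dest: in_set_takeD in_set_dropD)
  have map_inner: "map \<phi> (take i xs @ (xs ! i \<otimes> xs ! Suc i) # drop (i + 2) xs)
      = take i (map \<phi> xs) @ (map \<phi> xs ! i \<otimes>\<^bsub>L\<^esub> map \<phi> xs ! Suc i) # drop (i + 2) (map \<phi> xs)"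
    if "i < n" for i
  proof -
    have "xs ! i \<in> carrier G" "xs ! Suc i \<in> carrier G"
      using that len carr nth_mem by auto
    then show ?thesis
      using that len hom_mult[OF \<phi>] by (simp add: take_map drop_map)
  qed
  show "cochain_pullback G \<phi> (Suc n) (coboundary L n c) xs = coboundary G n (cochain_pullback G \<phi> n c) xs"
    using xs image outer inner map_inner
    by (simp add: cochain_pullback_apply coboundary_def restr_def map_tl map_butlast)
qed

section \<open>Cochains along a surjection\<close>

text \<open>
  Along a surjection \<open>p\<close>, cochains of the target are the cochains of the source that are constant
  on the fibres of \<open>p\<close>. So equations and bounds between cochains of a quotient can be checked
  on the group itself.
\<close>

lemma tuples_lift:
  assumes surj: "p ` carrier K = carrier L" and ys: "ys \<in> tuples L n"
  obtains xs where "xs \<in> tuples K n" "map p xs = ys"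
proof (rule that)
  let ?s = "inv_into (carrier K) p"
  show "map ?s ys \<in> tuples K n"
    using ys surj inv_into_into[of _ p "carrier K"] by (auto simp: tuples_def)
  show "map p (map ?s ys) = ys"
    using ys surj f_inv_into_f[of _ p "carrier K"] by (auto simp: tuples_def intro!: map_idI)
qed

lemma cochain_pullback_inj:
  assumes surj: "p ` carrier K = carrier L" and c: "c \<in> cochains L n" and d: "d \<in> cochains L n"
    and eq: "cochain_pullback K p n c = cochain_pullback K p n d"
  shows "c = d"
proof (rule cochains_eqI[OF c d])
  fix ys assume "ys \<in> tuples L n"
  then obtain xs where "xs \<in> tuples K n" "map p xs = ys"
    using tuples_lift[OF surj] by metis
  then show "c ys = d ys"
    using fun_cong[OF eq, of xs] by (simp add: cochain_pullback_apply)
qed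

lemma bounded_of_pullback_bounded:
  assumes surj: "p ` carrier K = carrier L" and c: "c \<in> cochains L n"
    and bd: "bounded (range (cochain_pullback K p n c))"
  shows "c \<in> bounded_cochains L n"
proof -
  have "c ys \<in> insert 0 (range (cochain_pullback K p n c))" for ys
  proof (cases "ys \<in> tuples L n")
    case True
    then obtain xs where "xs \<in> tuples K n" "map p xs = ys"
      using tuples_lift[OF surj] by metis
    then have "c ys = cochain_pullback K p n c xs"
      by (simp add: cochain_pullback_apply)
    then show ?thesis
      by blast
  qed (use c in \<open>simp add: cochains_def\<close>)
  then have "range c \<subseteq> insert 0 (range (cochain_pullback K p n c))"
    by blast
  then have "bounded (range c)"
    by (rule bounded_subset[rotated]) (use bd in simp)
  then show ?thesis
    using c by (simp add: bounded_cochains_def)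
qed

lemma cochain_descends:
  assumes surj: "p ` carrier K = carrier L" and e: "e \<in> cochains K n"
    and fibres: "\<And>xs ys. xs \<in> tuples K n \<Longrightarrow> ys \<in> tuples K n \<Longrightarrow> map p xs = map p ys \<Longrightarrow> e xs = e ys"
  obtains c where "c \<in> cochains L n" "cochain_pullback K p n c = e"
proof
  define c where "c = restr (tuples L n) (\<lambda>ys. e (SOME xs. xs \<in> tuples K n \<and> map p xs = ys))"
  show "c \<in> cochains L n"
    unfolding c_def by (rule restr_in_cochains)
  show "cochain_pullback K p n c = e"
  proof (rule cochains_eqI[OF cochain_pullback_in_cochains e])
    fix xs assume xs: "xs \<in> tuples K n"
    define zs where "zs = (SOME zs. zs \<in> tuples K n \<and> map p zs = map p xs)"
    have "zs \<in> tuples K n \<and> map p zs = map p xs"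
      unfolding zs_def by (rule someI[of _ xs]) (use xs in simp)
    then have "e zs = e xs"
      using fibres xs by blast
    moreover have "map p xs \<in> tuples L n"
      using xs surj by (auto simp: tuples_def)
    ultimately show "cochain_pullback K p n c xs = e xs"
      using xs by (simp add: cochain_pullback_apply c_def restr_def zs_def)
  qed
qed

section \<open>Vanishing of classes\<close>

lemma coset_fun_space: "V #>\<^bsub>fun_space W\<^esub> f = (\<lambda>v x. v x + f x) ` V"
  by (auto simp: r_coset_def fun_space_def)

lemma mem_if_coset_trivial:
  assumes "(\<lambda>_. 0) \<in> V" "V #>\<^bsub>fun_space W\<^esub> f = V"
  shows "f \<in> V"
proof -
  have "(\<lambda>x. 0 + f x) \<in> V #>\<^bsub>fun_space W\<^esub> f"
    unfolding coset_fun_space using assms(1) by (rule image_eqI[rotated]) simp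
  then show ?thesis
    using assms(2) by simp
qed

lemma coboundaries_2: "coboundaries K C 2 = coboundary K 1 ` C 1"
  by (simp add: coboundaries_def numeral_2_eq_2)

lemma cohomology_class_coboundary_shift:
  assumes c: "c \<in> cochains K 1"
  shows "cohomology_class K 2 (\<lambda>xs. coboundary K 1 c xs + z xs) = cohomology_class K 2 z"
proof -
  have "(\<lambda>xs. coboundary K 1 d xs + (coboundary K 1 c xs + z xs)) \<in> (\<lambda>b xs. b xs + z xs) ` coboundary K 1 ` cochains K 1"
    if "d \<in> cochains K 1" for d
    using cochains_add[OF that c]
    by (intro image_eqI[OF _ imageI]) (auto simp: coboundary_add)
  moreover have "(\<lambda>xs. coboundary K 1 d xs + z xs)
      \<in> (\<lambda>b xs. b xs + (coboundary K 1 c xs + z xs)) ` coboundary K 1 ` cochains K 1"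
    if "d \<in> cochains K 1" for d
    using cochains_diff[OF that c]
    by (intro image_eqI[OF _ imageI]) (auto simp: coboundary_diff)
  ultimately show ?thesis
    unfolding cohomology_class_def coset_fun_space coboundaries_2 by blast
qed

lemma cohomology_class_trivial:
  assumes "z \<in> coboundaries K (cochains K) 2"
  shows "cohomology_class K 2 z = \<one>\<^bsub>cohomology K 2\<^esub>"
proof -
  obtain c where c: "c \<in> cochains K 1" "z = coboundary K 1 c"
    using assms by (auto simp: coboundaries_2)
  have "cohomology_class K 2 z = cohomology_class K 2 (\<lambda>_. 0)"
    using cohomology_class_coboundary_shift[OF c(1), of "\<lambda>_. 0"] c(2) by simp
  then show ?thesis
    by (simp add: cohomology_class_def coset_fun_space complex_cohomology_def)
qed

lemma (in monoid) cohomology_pullback_class: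
  assumes \<phi>: "\<phi> \<in> hom G L"
  shows "cohomology_pullback G \<phi> 2 (cohomology_class L 2 z)
    = cohomology_class G 2 (cochain_pullback G \<phi> 2 z)"
proof -
  have "cohomology_class G 2 (cochain_pullback G \<phi> 2 (\<lambda>xs. coboundary L 1 c xs + z xs))
      = cohomology_class G 2 (cochain_pullback G \<phi> 2 z)" for c
    using cohomology_class_coboundary_shift[OF cochain_pullback_in_cochains]
      cochain_pullback_coboundary[OF \<phi>, of 1 c]
    by (simp add: cochain_pullback_add numeral_2_eq_2)
  then have "(\<lambda>y. cohomology_class G 2 (cochain_pullback G \<phi> 2 y)) ` cohomology_class L 2 z
      = {cohomology_class G 2 (cochain_pullback G \<phi> 2 z)}"
    using cochains_zero[of L 1]
    unfolding cohomology_class_def[of L] coset_fun_space coboundaries_2 image_image by blast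
  then show ?thesis
    by (simp add: cohomology_pullback_def)
qed

lemma bounded_cochainI:
  assumes "c \<in> cochains K n" "\<And>xs. xs \<in> tuples K n \<Longrightarrow> \<bar>c xs\<bar> \<le> B"
  shows "c \<in> bounded_cochains K n"
proof -
  have "\<bar>c xs\<bar> \<le> \<bar>B\<bar>" for xs
    using assms(2)[of xs] assms(1) by (cases "xs \<in> tuples K n") (auto simp: cochains_def)
  then have "bounded (range c)"
    by (auto simp: bounded_iff)
  then show ?thesis
    using assms(1) by (simp add: bounded_cochains_def)
qed

lemma bounded_cochainE:
  assumes "c \<in> bounded_cochains K n"
  obtains B where "\<And>xs. \<bar>c xs\<bar> \<le> B"
  using assms by (auto simp: bounded_cochains_def bounded_iff)

lemma bounded_cochains_diff:
  assumes "c \<in> bounded_cochains K n" "d \<in> bounded_cochains K n"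
  shows "(\<lambda>xs. c xs - d xs) \<in> bounded_cochains K n"
  using assms by (auto simp: bounded_cochains_def cochains_diff intro: bounded_minus_comp)

lemma (in monoid) bounded_coboundary_1:
  assumes "c \<in> bounded_cochains G 1"
  shows "coboundary G 1 c \<in> bounded_cochains G 2"
proof -
  obtain B where B: "\<And>xs. \<bar>c xs\<bar> \<le> B"
    using bounded_cochainE[OF assms] by blast
  show ?thesis
  proof (rule bounded_cochainI[OF coboundary_1_in_cochains])
    fix xs assume "xs \<in> tuples G 2"
    then obtain g h where gh: "g \<in> carrier G" "h \<in> carrier G" "xs = [g, h]"
      by (rule tuples_2E)
    show "\<bar>coboundary G 1 c xs\<bar> \<le> 3 * B"
      using gh B[of "[g]"] B[of "[h]"] B[of "[g \<otimes> h]"] by (simp add: coboundary_1 del: One_nat_def)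
  qed
qed

text \<open>
  Each bounded cocycle is then a bounded coboundary: its class is a coset of the bounded
  coboundaries, and triviality of the group says that there is only one coset.
\<close>

lemma trivial_bounded_cohomologyE:
  assumes triv: "trivial_group (bounded_cohomology K 2)"
    and z: "z \<in> cocycles K (bounded_cochains K) 2"
  obtains b where "b \<in> bounded_cochains K 1" "z = coboundary K 1 b"
proof -
  let ?B = "coboundaries K (bounded_cochains K) 2"
  have "(\<lambda>_. 0) \<in> bounded_cochains K 1"
    by (rule bounded_cochainI[OF cochains_zero, where B = 0]) simp
  then have zero: "(\<lambda>_. 0) \<in> ?B"
    unfolding coboundaries_2 by (rule image_eqI[rotated]) (simp add: coboundary_zero)
  have "?B #>\<^bsub>fun_space (cocycles K (bounded_cochains K) 2)\<^esub> z \<in> carrier (bounded_cohomology K 2)"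
    using z by (auto simp: complex_cohomology_def carrier_FactGroup fun_space_def)
  then have "?B #>\<^bsub>fun_space (cocycles K (bounded_cochains K) 2)\<^esub> z = ?B"
    using triv by (simp add: trivial_group_def complex_cohomology_def)
  then have "z \<in> ?B"
    by (rule mem_if_coset_trivial[OF zero])
  then show thesis
    using that by (auto simp: coboundaries_2)
qed

section \<open>Cochains on a group and on its quotient\<close>

lemma (in normal) rcos_eq_mult_left:
  assumes "n \<in> H" "g \<in> carrier G"
  shows "H #> (n \<otimes> g) = H #> g"
  using assms repr_independence[of "n \<otimes> g" H g] subgroup_axioms by (auto simp: r_coset_def)

lemma (in normal) rcos_eqE:
  assumes "H #> g = H #> h" "g \<in> carrier G" "h \<in> carrier G"
  obtains n where "n \<in> H" "g = n \<otimes> h"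
  using assms rcos_self[of g H] subgroup_axioms by (auto simp: r_coset_def)

lemma (in normal) rcos_image_carrier: "(\<lambda>g. H #> g) ` carrier G = carrier (G Mod H)"
  by (simp add: carrier_FactGroup)

lemma (in normal) rcos_in_quotient: "g \<in> carrier G \<Longrightarrow> H #> g \<in> carrier (G Mod H)"
  by (simp add: carrier_FactGroup)

lemma (in normal) rcos_of_mem: "n \<in> H \<Longrightarrow> H #> n = H"
  using coset_join2[OF mem_carrier subgroup_axioms] by blast

lemma (in normal) coset_representatives:
  obtains s where "\<And>g. g \<in> carrier G \<Longrightarrow> s (H #> g) \<in> carrier G \<and> g \<otimes> inv s (H #> g) \<in> H"
proof
  fix g assume g: "g \<in> carrier G"
  define t where "t = (SOME x. x \<in> H #> g)"
  have "t \<in> H #> g"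
    unfolding t_def by (rule someI) (rule rcos_self[OF g subgroup_axioms])
  then obtain n where n: "n \<in> H" "t = n \<otimes> g"
    by (auto simp: r_coset_def)
  then have "g \<otimes> inv t = inv n"
    using g mem_carrier[OF n(1)] by (simp add: inv_mult_group m_assoc[symmetric])
  then show "(SOME x. x \<in> H #> g) \<in> carrier G \<and> g \<otimes> inv (SOME x. x \<in> H #> g) \<in> H"
    using n g mem_carrier[OF n(1)] by (simp flip: t_def)
qed

text \<open>
  Choose representatives of the cosets and let \<open>w\<close> be \<open>\<phi>\<close> of the \<open>H\<close>-component of an
  element. Then \<open>w\<close> extends \<open>\<phi>\<close> equivariantly, and its coboundary is constant on pairs of
  cosets: moving \<open>g\<close> to \<open>n \<otimes> g\<close> and \<open>h\<close> to \<open>m \<otimes> h\<close> changes \<open>w (g \<otimes> h)\<close> by \<open>\<phi> n\<close> plus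
  \<open>\<phi>\<close> of the conjugate of \<open>m\<close> by \<open>g\<close>, and invariance of \<open>\<phi>\<close> makes this the change of
  \<open>w g + w h\<close>. The cocycle obtained on the quotient represents, up to sign, the image of \<open>\<phi>\<close>
  under the transgression of the group extension.
\<close>

lemma (in normal) invariant_hom_extension:
  assumes \<phi>: "\<phi> \<in> invariant_homs G H"
  obtains w where "w \<in> cochains G 1"
    "\<And>n g. n \<in> H \<Longrightarrow> g \<in> carrier G \<Longrightarrow> w [n \<otimes> g] = \<phi> n + w [g]"
    "\<And>xs ys. xs \<in> tuples G 2 \<Longrightarrow> ys \<in> tuples G 2 \<Longrightarrow>
      map (\<lambda>g. H #> g) xs = map (\<lambda>g. H #> g) ys \<Longrightarrow> coboundary G 1 w xs = coboundary G 1 w ys"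
proof -
  have hom: "\<phi> (x \<otimes> y) = \<phi> x + \<phi> y" if "x \<in> H" "y \<in> H" for x y
    using \<phi> that by (simp add: invariant_homs_def)
  have inv: "\<phi> (g \<otimes> x \<otimes> inv g) = \<phi> x" if "g \<in> carrier G" "x \<in> H" for g x
    using \<phi> that by (simp add: invariant_homs_def conj_invariant_def)
  obtain s where s: "\<And>g. g \<in> carrier G \<Longrightarrow> s (H #> g) \<in> carrier G \<and> g \<otimes> inv s (H #> g) \<in> H"
    using coset_representatives by blast
  define w where "w = restr (tuples G 1) (\<lambda>xs. \<phi> (hd xs \<otimes> inv s (H #> hd xs)))"
  have w: "w [g] = \<phi> (g \<otimes> inv s (H #> g))" if "g \<in> carrier G" for g
    using that unfolding w_def restr_def singleton_in_tuples by simp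
  have left: "w [n \<otimes> g] = \<phi> n + w [g]" if n: "n \<in> H" and g: "g \<in> carrier G" for n g
  proof -
    have "n \<otimes> g \<otimes> inv s (H #> g) = n \<otimes> (g \<otimes> inv s (H #> g))"
      using s[OF g] g mem_carrier[OF n] by (simp add: m_assoc)
    then show ?thesis
      using w[OF g] w[of "n \<otimes> g"] s[OF g] hom[OF n] rcos_eq_mult_left[OF n g] g mem_carrier[OF n] by simp
  qed
  have fibre: "coboundary G 1 w [n \<otimes> g, m \<otimes> h] = coboundary G 1 w [g, h]"
    if n: "n \<in> H" and m: "m \<in> H" and g: "g \<in> carrier G" and h: "h \<in> carrier G" for n m g h
  proof -
    have m': "g \<otimes> m \<otimes> inv g \<in> H"
      using inv_op_closed2[OF g m] .
    have carr: "n \<in> carrier G" "m \<in> carrier G"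
      using n m mem_carrier by auto
    have cancel: "inv g \<otimes> (g \<otimes> h) = h"
      using g h m_assoc[of "inv g" g h] by simp
    have "n \<otimes> (g \<otimes> m \<otimes> inv g) \<otimes> (g \<otimes> h) = n \<otimes> g \<otimes> (m \<otimes> (inv g \<otimes> (g \<otimes> h)))"
      using g h carr by (simp add: m_assoc)
    then have "n \<otimes> g \<otimes> (m \<otimes> h) = n \<otimes> (g \<otimes> m \<otimes> inv g) \<otimes> (g \<otimes> h)"
      by (simp only: cancel)
    then have "w [n \<otimes> g \<otimes> (m \<otimes> h)] = \<phi> n + \<phi> m + w [g \<otimes> h]"
      using left[of "n \<otimes> (g \<otimes> m \<otimes> inv g)" "g \<otimes> h"] hom[OF n m'] inv[OF g m] n m' g h by simp
    then show ?thesis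
      using left[OF n g] left[OF m h] g h carr by (simp add: coboundary_1 del: One_nat_def)
  qed
  show thesis
  proof
    show "w \<in> cochains G 1"
      unfolding w_def by (rule restr_in_cochains)
    show "w [n \<otimes> g] = \<phi> n + w [g]" if "n \<in> H" "g \<in> carrier G" for n g
      using left that .
    fix xs ys assume tuples: "xs \<in> tuples G 2" "ys \<in> tuples G 2"
      and eq: "map (\<lambda>g. H #> g) xs = map (\<lambda>g. H #> g) ys"
    obtain g h where gh: "g \<in> carrier G" "h \<in> carrier G" "xs = [g, h]"
      using tuples_2E[OF tuples(1)] .
    obtain g' h' where gh': "g' \<in> carrier G" "h' \<in> carrier G" "ys = [g', h']"
      using tuples_2E[OF tuples(2)] .
    have cosets: "H #> g = H #> g'" "H #> h = H #> h'"
      using eq gh(3) gh'(3) by auto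
    obtain n where n: "n \<in> H" "g = n \<otimes> g'"
      using rcos_eqE[OF cosets(1) gh(1) gh'(1)] .
    obtain m where m: "m \<in> H" "h = m \<otimes> h'"
      using rcos_eqE[OF cosets(2) gh(2) gh'(2)] .
    show "coboundary G 1 w xs = coboundary G 1 w ys"
      using fibre[OF n(1) m(1) gh'(1,2)] gh(3) gh'(3) n(2) m(2) by simp
  qed
qed

text \<open>
  Take for \<open>v\<close> the values of \<open>f\<close> at representatives of the cosets. An element of \<open>G\<close> is its
  representative multiplied by an element of \<open>H\<close>, so the error is at most \<open>B\<close>.
\<close>

lemma (in normal) cochain_descends_up_to_bounded:
  assumes f: "f \<in> cochains G 1"
    and change: "\<And>n g. n \<in> H \<Longrightarrow> g \<in> carrier G \<Longrightarrow> \<bar>f [n \<otimes> g] - f [g]\<bar> \<le> B"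
  obtains v where "v \<in> cochains (G Mod H) 1"
    "(\<lambda>xs. f xs - cochain_pullback G (\<lambda>g. H #> g) 1 v xs) \<in> bounded_cochains G 1"
proof -
  obtain s where s: "\<And>g. g \<in> carrier G \<Longrightarrow> s (H #> g) \<in> carrier G \<and> g \<otimes> inv s (H #> g) \<in> H"
    using coset_representatives by blast
  define v where "v = restr (tuples (G Mod H) 1) (\<lambda>Xs. f (map s Xs))"
  have "(\<lambda>xs. f xs - cochain_pullback G (\<lambda>g. H #> g) 1 v xs) \<in> bounded_cochains G 1"
  proof (rule bounded_cochainI[OF cochains_diff[OF f cochain_pullback_in_cochains]])
    fix xs assume "xs \<in> tuples G 1"
    then obtain g where g: "g \<in> carrier G" and xs: "xs = [g]"
      by (rule tuples_1E)
    have "H #> g \<in> carrier (G Mod H)"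
      using g rcos_image_carrier by blast
    then have "cochain_pullback G (\<lambda>g. H #> g) 1 v xs = f [s (H #> g)]"
      using g unfolding xs v_def cochain_pullback_def restr_def list.map singleton_in_tuples by simp
    moreover have "g = g \<otimes> inv s (H #> g) \<otimes> s (H #> g)"
      using s[OF g] g by (simp add: m_assoc)
    ultimately show "\<bar>f xs - cochain_pullback G (\<lambda>g. H #> g) 1 v xs\<bar> \<le> B"
      using change[of "g \<otimes> inv s (H #> g)" "s (H #> g)"] s[OF g] xs by metis
  qed
  moreover have "v \<in> cochains (G Mod H) 1"
    unfolding v_def by (rule restr_in_cochains)
  ultimately show thesis
    using that by blast
qed

text \<open>
  This is the cohomological core, independent of the circle. By hypothesis \<open>p\<^sup>* A + \<delta>u\<close> is
  bounded and \<open>u\<close> restricts to an invariant homomorphism on \<open>H\<close>. Extending that homomorphism to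
  \<open>w\<close> and subtracting it, \<open>u - w\<close> varies boundedly on cosets and so equals \<open>p\<^sup>* v + r\<close> with
  \<open>r\<close> bounded, while \<open>\<delta>w = p\<^sup>* E\<close>. Hence \<open>A + \<delta>v + E\<close> pulls back to
  \<open>p\<^sup>* A + \<delta>u - \<delta>r\<close> and is a bounded cocycle of the quotient. As such it is \<open>\<delta>b\<close>, which
  gives \<open>p\<^sup>* A = \<delta>(p\<^sup>* b - p\<^sup>* v - w)\<close>.
\<close>

theorem (in normal) inflated_cocycle_trivial:
  fixes p
  defines "p \<equiv> \<lambda>g. H #> g"
  assumes A: "A \<in> cocycles (G Mod H) (cochains (G Mod H)) 2" "normalized (G Mod H) 2 A"
    and u: "u \<in> cochains G 1" "restr H (\<lambda>x. u [x]) \<in> invariant_homs G H"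
    and bounded: "(\<lambda>xs. cochain_pullback G p 2 A xs + coboundary G 1 u xs) \<in> bounded_cochains G 2"
    and triv: "trivial_group (bounded_cohomology (G Mod H) 2)"
  shows "cochain_pullback G p 2 A \<in> coboundaries G (cochains G) 2"
proof -
  let ?Q = "G Mod H"
  let ?p1 = "cochain_pullback G p 1" and ?p2 = "cochain_pullback G p 2"
  have hom: "p \<in> hom G ?Q"
    unfolding p_def by (rule r_coset_hom_Mod)
  have surj: "p ` carrier G = carrier ?Q"
    unfolding p_def by (rule rcos_image_carrier)
  note pull1 = cochain_pullback_coboundary[OF hom, of 1, unfolded Suc_1]
  note pull2 = cochain_pullback_coboundary[OF hom, of 2]
  have A': "A \<in> cochains ?Q 2" "coboundary ?Q 2 A = (\<lambda>_. 0)"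
    using A(1) by (auto simp: cocycles_def)
  obtain B where B: "\<And>xs. \<bar>?p2 A xs + coboundary G 1 u xs\<bar> \<le> B"
    using bounded_cochainE[OF bounded] by blast
  obtain w where w: "w \<in> cochains G 1"
    "\<And>n g. n \<in> H \<Longrightarrow> g \<in> carrier G \<Longrightarrow> w [n \<otimes> g] = restr H (\<lambda>x. u [x]) n + w [g]"
    "\<And>xs ys. xs \<in> tuples G 2 \<Longrightarrow> ys \<in> tuples G 2 \<Longrightarrow> map p xs = map p ys \<Longrightarrow>
      coboundary G 1 w xs = coboundary G 1 w ys"
    using invariant_hom_extension[OF u(2)] unfolding p_def by metis
  obtain E where E: "E \<in> cochains ?Q 2" "?p2 E = coboundary G 1 w"
    using cochain_descends[OF surj coboundary_1_in_cochains w(3)] .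
  define f where "f = (\<lambda>xs. u xs - w xs)"
  have f: "f \<in> cochains G 1"
    unfolding f_def by (rule cochains_diff[OF u(1) w(1)])
  \<comment> \<open>On \<open>(n, g)\<close> the cocycle \<open>A\<close> vanishes, so the bound on \<open>p\<^sup>* A + \<delta>u\<close> controls \<open>u\<close> along cosets.\<close>
  have "\<bar>f [n \<otimes> g] - f [g]\<bar> \<le> B" if n: "n \<in> H" and g: "g \<in> carrier G" for n g
  proof -
    have "[p n, p g] \<in> tuples ?Q 2" "p n = \<one>\<^bsub>?Q\<^esub>"
      using rcos_of_mem[OF n] rcos_in_quotient[OF mem_carrier[OF n]] rcos_in_quotient[OF g]
      by (simp_all add: p_def)
    then have "A [p n, p g] = 0"
      using A(2) by (simp add: normalized_def)
    then have "?p2 A [n, g] = 0"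
      using n g by (simp add: cochain_pullback_apply)
    then have "?p2 A [n, g] + coboundary G 1 u [n, g] = u [g] - u [n \<otimes> g] + u [n]"
      using n g by (simp add: coboundary_1 del: One_nat_def)
    moreover have "w [n \<otimes> g] = u [n] + w [g]"
      using w(2)[OF n g] n by (simp add: restr_def)
    ultimately show ?thesis
      using B[of "[n, g]"] by (simp add: f_def)
  qed
  then obtain v where v: "v \<in> cochains ?Q 1" and r: "(\<lambda>xs. f xs - ?p1 v xs) \<in> bounded_cochains G 1"
    using cochain_descends_up_to_bounded[OF f] unfolding p_def by metis
  define A1 where "A1 = (\<lambda>xs. A xs + coboundary ?Q 1 v xs + E xs)"
  have A1: "A1 \<in> cochains ?Q 2"
    unfolding A1_def by (intro cochains_add A'(1) E(1) coboundary_1_in_cochains)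
  have pA1: "?p2 A1 = (\<lambda>xs. ?p2 A xs + coboundary G 1 (\<lambda>xs. ?p1 v xs + w xs) xs)"
    unfolding A1_def cochain_pullback_add pull1 E(2) coboundary_add by (simp add: add.assoc)
  \<comment> \<open>The difference of \<open>u\<close> and \<open>p\<^sup>* v + w\<close> is the bounded cochain \<open>r\<close>, so the pullback of \<open>A1\<close> is bounded.\<close>
  have "?p2 A1 = (\<lambda>xs. (?p2 A xs + coboundary G 1 u xs) - coboundary G 1 (\<lambda>xs. f xs - ?p1 v xs) xs)"
    unfolding pA1 f_def coboundary_add coboundary_diff by (simp add: fun_eq_iff)
  then have "?p2 A1 \<in> bounded_cochains G 2"
    using bounded_cochains_diff[OF bounded bounded_coboundary_1[OF r]] by simp
  then have bdA1: "A1 \<in> bounded_cochains ?Q 2"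
    by (intro bounded_of_pullback_bounded[OF surj A1]) (simp add: bounded_cochains_def)
  have "cochain_pullback G p (Suc 2) (coboundary ?Q 2 A1) = cochain_pullback G p (Suc 2) (\<lambda>_. 0)"
    unfolding pull2 pA1 coboundary_add[of G 2] coboundary_coboundary_1
    by (simp add: A'(2) cochain_pullback_zero flip: pull2)
  then have "coboundary ?Q 2 A1 = (\<lambda>_. 0)"
    by (rule cochain_pullback_inj[OF surj coboundary_in_cochains cochains_zero])
  then have "A1 \<in> cocycles ?Q (bounded_cochains ?Q) 2"
    using bdA1 by (simp add: cocycles_def)
  then obtain b where b: "b \<in> bounded_cochains ?Q 1" "A1 = coboundary ?Q 1 b"
    by (rule trivial_bounded_cohomologyE[OF triv])
  have "?p2 A = coboundary G 1 (\<lambda>xs. ?p1 b xs - (?p1 v xs + w xs))"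
    using pA1 unfolding b(2) pull1 coboundary_diff by (simp add: fun_eq_iff)
  then show ?thesis
    unfolding coboundaries_2
    by (rule image_eqI[OF _ cochains_diff[OF cochain_pullback_in_cochains
            cochains_add[OF cochain_pullback_in_cochains w(1)]]])
qed

section \<open>The primitive on the normal subgroup\<close>

text \<open>
  Powers of one element commute, so the function is a homomorphism on each cyclic subgroup.
\<close>

lemma (in group) additive_on_commuting_imp_homogeneous:
  fixes f :: "'a \<Rightarrow> real"
  assumes add: "\<And>x y. x \<in> carrier G \<Longrightarrow> y \<in> carrier G \<Longrightarrow> x \<otimes> y = y \<otimes> x \<Longrightarrow> f (x \<otimes> y) = f x + f y"
    and x: "x \<in> carrier G"
  shows "f (x [^] (n::int)) = of_int n * f x"
proof -
  have powers: "f (x [^] (m + n)) = f (x [^] m) + f (x [^] n)" for m n :: int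
    using add[of "x [^] m" "x [^] n"] x by (simp add: int_pow_mult[symmetric] add.commute)
  have step: "f (x [^] (m + 1)) = f (x [^] m) + f x" for m :: int
    using powers[of m 1] x by simp
  have zero: "f (x [^] (0::int)) = 0"
    using powers[of 0 0] by simp
  show ?thesis
  proof (induction n rule: int_induct[where k = 0])
    case base
    then show ?case
      using zero by simp
  next
    case (step1 i)
    then show ?case
      using step[of i] by (simp add: algebra_simps)
  next
    case (step2 i)
    then show ?case
      using step[of "i - 1"] by (simp add: algebra_simps)
  qed
qed

locale euler_primitive = normal N G for N and G (structure) +
  fixes \<rho> :: "'a \<Rightarrow> circle \<Rightarrow> circle" and A u
  assumes rho: "\<rho> \<in> hom G Homeo_plus"
    and normalized: "normalized (G Mod N) 2 A"
    and primitive: "(\<lambda>xs. cochain_pullback G \<rho> 2 euler_cocycle xs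
      - cochain_pullback G (\<lambda>g. N #> g) 2 A xs) = coboundary G 1 u"
begin

text \<open>
  Since \<open>A\<close> is normalized, its pullback vanishes as soon as one argument lies in \<open>N\<close>; there the
  coboundary equation for \<open>u\<close> involves the Euler cocycle alone.
\<close>

lemma primitive_mult:
  assumes x: "x \<in> N" and g: "g \<in> carrier G"
  shows "u [x \<otimes> g] = u [x] + u [g] - euler_cocycle [\<rho> x, \<rho> g]"
    and "u [g \<otimes> x] = u [g] + u [x] - euler_cocycle [\<rho> g, \<rho> x]"
proof -
  have "[N, N #> g] \<in> tuples (G Mod N) 2" "[N #> g, N] \<in> tuples (G Mod N) 2"
    using rcos_of_mem[OF x] rcos_in_quotient[OF mem_carrier[OF x]] rcos_in_quotient[OF g] by simp_all
  then have "A [N, N #> g] = 0" "A [N #> g, N] = 0"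
    using normalized by (simp_all add: normalized_def)
  then show "u [x \<otimes> g] = u [x] + u [g] - euler_cocycle [\<rho> x, \<rho> g]"
    "u [g \<otimes> x] = u [g] + u [x] - euler_cocycle [\<rho> g, \<rho> x]"
    using fun_cong[OF primitive, of "[x, g]"] fun_cong[OF primitive, of "[g, x]"] x g
    by (simp_all add: cochain_pullback_apply coboundary_1 rcos_of_mem del: One_nat_def)
qed

lemma rho_closed: "g \<in> carrier G \<Longrightarrow> \<rho> g \<in> carrier Homeo_plus"
  using rho by (auto simp: hom_def)

lemma rho_mult: "g \<in> carrier G \<Longrightarrow> h \<in> carrier G \<Longrightarrow> \<rho> (g \<otimes> h) = \<rho> g \<circ> \<rho> h"
  using rho by (simp add: hom_def Homeo_plus_def)

lemma primitive_conj_invariant: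
  assumes g: "g \<in> carrier G" and x: "x \<in> N"
  shows "u [g \<otimes> x \<otimes> inv g] = u [x]"
proof -
  let ?y = "g \<otimes> x \<otimes> inv g"
  have y: "?y \<in> N" "?y \<in> carrier G" and eq: "?y \<otimes> g = g \<otimes> x"
    using inv_op_closed2[OF g x] g x by (simp_all add: m_assoc)
  have "\<rho> ?y \<circ> \<rho> g = \<rho> g \<circ> \<rho> x"
    using eq rho_mult[of ?y g] rho_mult[of g x] g x y by simp
  then have "euler_cocycle [\<rho> ?y, \<rho> g] = euler_cocycle [\<rho> g, \<rho> x]"
    using g x y by (intro euler_cocycle_conjugate rho_closed) auto
  then show ?thesis
    using primitive_mult(1)[OF y(1) g] primitive_mult(2)[OF x g] eq by simp
qed

lemma primitive_add_commuting:
  assumes x: "x \<in> N" and y: "y \<in> N" and comm: "x \<otimes> y = y \<otimes> x"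
  shows "u [x \<otimes> y] = u [x] + u [y]"
proof -
  have "\<rho> x \<circ> \<rho> y = \<rho> y \<circ> \<rho> x"
    using comm rho_mult[of x y] rho_mult[of y x] x y by simp
  then have "euler_cocycle [\<rho> x, \<rho> y] = 0"
    using x y by (intro euler_cocycle_commuting rho_closed) auto
  then show ?thesis
    using primitive_mult(1)[OF x mem_carrier[OF y]] by simp
qed

theorem primitive_restr_invariant_quasimorphism:
  "restr N (\<lambda>x. u [x]) \<in> invariant_quasimorphisms G N"
proof -
  let ?K = "G\<lparr>carrier := N\<rparr>" and ?f = "restr N (\<lambda>x. u [x])"
  interpret K: group ?K
    using subgroup_is_group[OF is_group] .
  have f: "?f x = u [x]" if "x \<in> N" for x
    using that by (simp add: restr_def)
  have "\<bar>?f (g \<otimes> h) - ?f g - ?f h\<bar> \<le> 4" if "g \<in> N" "h \<in> N" for g h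
    using euler_cocycle_bounded[of "\<rho> g" "\<rho> h"] that primitive_mult(1)[of g h] rho_closed f by simp
  then have "bdd_above {\<bar>?f (g \<otimes>\<^bsub>?K\<^esub> h) - ?f g - ?f h\<bar> |g h. g \<in> carrier ?K \<and> h \<in> carrier ?K}"
    by (intro bdd_aboveI[where M = 4]) auto
  moreover have "?f (g [^]\<^bsub>?K\<^esub> n) = of_int n * ?f g" if "g \<in> carrier ?K" for g and n :: int
    by (rule K.additive_on_commuting_imp_homogeneous[OF _ that])
      (auto simp: f primitive_add_commuting)
  moreover have "conj_invariant G N ?f"
    using primitive_conj_invariant inv_op_closed2 by (simp add: conj_invariant_def f)
  ultimately show ?thesis
    by (simp add: invariant_quasimorphisms_def homogeneous_quasimorphisms_def restr_def)
qed

text \<open>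
  Subtract the quasimorphism \<open>\<mu>\<close> from \<open>u\<close>. The restriction to \<open>N\<close> becomes the invariant
  homomorphism \<open>\<phi>\<close>, and \<open>p\<^sup>* A + \<delta>(u - \<mu>)\<close> is the pulled back Euler cocycle minus
  \<open>\<delta>\<mu>\<close>, which is bounded. So \<open>p\<^sup>* A\<close> is a coboundary, and with it the Euler cocycle.
\<close>

lemma euler_class_trivial_if_decomposes:
  assumes A: "A \<in> cocycles (G Mod N) (cochains (G Mod N)) 2"
    and u: "u \<in> cochains G 1"
    and triv: "trivial_group (bounded_cohomology (G Mod N) 2)"
    and \<phi>: "\<phi> \<in> invariant_homs G N" and \<mu>: "\<mu> \<in> homogeneous_quasimorphisms G"
    and decomp: "\<And>x. x \<in> N \<Longrightarrow> u [x] = \<phi> x + \<mu> x"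
  shows "cochain_pullback G \<rho> 2 euler_cocycle \<in> coboundaries G (cochains G) 2"
proof -
  let ?e = "cochain_pullback G \<rho> 2 euler_cocycle" and ?A = "cochain_pullback G (\<lambda>g. N #> g) 2 A"
  define m where "m = restr (tuples G 1) (\<lambda>xs. \<mu> (hd xs))"
  have m: "m \<in> cochains G 1"
    unfolding m_def by (rule restr_in_cochains)
  have m_apply: "m [g] = \<mu> g" if "g \<in> carrier G" for g
    using that unfolding m_def restr_def singleton_in_tuples by simp
  have e: "?e xs = ?A xs + coboundary G 1 u xs" for xs
    using fun_cong[OF primitive, of xs] by simp
  have "restr N (\<lambda>x. u [x] - m [x]) = \<phi>"
    using \<phi> decomp m_apply by (auto simp: fun_eq_iff restr_def invariant_homs_def)
  moreover have "(\<lambda>xs. ?A xs + coboundary G 1 (\<lambda>xs. u xs - m xs) xs) \<in> bounded_cochains G 2"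
  proof -
    have "?e \<in> bounded_cochains G 2"
      by (rule bounded_cochainI[OF cochain_pullback_in_cochains, where B = 4])
        (auto elim!: tuples_2E simp: cochain_pullback_apply euler_cocycle_bounded rho_closed)
    moreover have "coboundary G 1 m \<in> bounded_cochains G 2"
    proof -
      obtain D where "\<And>g h. g \<in> carrier G \<Longrightarrow> h \<in> carrier G \<Longrightarrow> \<bar>\<mu> (g \<otimes> h) - \<mu> g - \<mu> h\<bar> \<le> D"
        using \<mu> unfolding homogeneous_quasimorphisms_def bdd_above_def by blast
      then have "\<bar>coboundary G 1 m [g, h]\<bar> \<le> D" if "g \<in> carrier G" "h \<in> carrier G" for g h
        using that by (simp add: coboundary_1 m_apply abs_minus_commute algebra_simps del: One_nat_def)
      then show ?thesis
        by (intro bounded_cochainI[OF coboundary_1_in_cochains]) (auto elim!: tuples_2E)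
    qed
    ultimately show ?thesis
      using bounded_cochains_diff[of ?e] by (simp add: e coboundary_diff add_diff_eq)
  qed
  ultimately have "?A \<in> coboundaries G (cochains G) 2"
    using \<phi> by (intro inflated_cocycle_trivial[OF A normalized cochains_diff[OF u m] _ _ triv]) simp_all
  then obtain a where a: "a \<in> cochains G 1" "?A = coboundary G 1 a"
    by (auto simp: coboundaries_2)
  then have "?e = coboundary G 1 (\<lambda>xs. a xs + u xs)"
    by (simp add: fun_eq_iff e coboundary_add)
  then show ?thesis
    unfolding coboundaries_2 using cochains_add[OF a(1) u] by blast
qed

end

lemma zero_invariant_hom: "(\<lambda>_. 0) \<in> invariant_homs G N"
  by (simp add: invariant_homs_def conj_invariant_def)

lemma zero_homogeneous_quasimorphism: "(\<lambda>_. 0) \<in> homogeneous_quasimorphisms G"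
  by (auto simp: homogeneous_quasimorphisms_def intro: bdd_aboveI[where M = 0])

lemma W_denominator_iff:
  "\<nu> \<in> W_denominator G N \<longleftrightarrow>
    (\<exists>\<phi> \<in> invariant_homs G N. \<exists>\<mu> \<in> homogeneous_quasimorphisms G. \<nu> = (\<lambda>x. \<phi> x + restr N \<mu> x))"
  by (auto simp: W_denominator_def set_mult_def fun_space_def)

lemma W_class_trivialD:
  assumes "W_class G N \<nu> = \<one>\<^bsub>W_space G N\<^esub>"
  shows "\<nu> \<in> W_denominator G N"
proof (rule mem_if_coset_trivial)
  have "(\<lambda>_. 0) = (\<lambda>x. 0 + restr N (\<lambda>_. 0) x)"
    by (simp add: restr_def)
  then show "(\<lambda>_. 0) \<in> W_denominator G N"
    unfolding W_denominator_iff
    by (rule bexI[OF bexI[OF _ zero_homogeneous_quasimorphism] zero_invariant_hom])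
  show "W_denominator G N #>\<^bsub>fun_space (invariant_quasimorphisms G N)\<^esub> \<nu> = W_denominator G N"
    using assms by (simp add: W_class_def W_space_def)
qed

theorem theorem1p1:
  fixes G :: "('a, 'm) monoid_scheme"
    and N :: "'a set"
    and \<Gamma> :: "'a set monoid"
    and p :: "'a \<Rightarrow> 'a set"
    and \<rho> :: "'a \<Rightarrow> circle \<Rightarrow> circle"
    and A :: "'a set list \<Rightarrow> real"
    and u :: "'a list \<Rightarrow> real"
    and \<nu> :: "'a \<Rightarrow> real"
  assumes "group G"
    and "N \<lhd> G"
    and Gamma_def: "\<Gamma> = G Mod N"
    and p_def: "p = (\<lambda>g. N #>\<^bsub>G\<^esub> g)"
    and "\<rho> \<in> hom G Homeo_plus"
    and "cohomology_pullback G \<rho> 2 real_euler_class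
           \<in> cohomology_pullback G p 2 ` carrier (cohomology \<Gamma> 2)"
    and "A \<in> cocycles \<Gamma> (cochains \<Gamma>) 2"
    and "normalized \<Gamma> 2 A"
    and "u \<in> cochains G 1"
    and "(\<lambda>xs. cochain_pullback G \<rho> 2 euler_cocycle xs - cochain_pullback G p 2 A xs)
           = coboundary G 1 u"
    and nu_def: "\<nu> = restr N (\<lambda>x. u [x])"
    and "trivial_group (bounded_cohomology \<Gamma> 2)"
  shows "\<nu> \<in> invariant_quasimorphisms G N \<and>
    (cohomology_pullback G \<rho> 2 real_euler_class \<noteq> \<one>\<^bsub>cohomology G 2\<^esub> \<longrightarrow>
       W_class G N \<nu> \<noteq> \<one>\<^bsub>W_space G N\<^esub> \<and>
       \<not> (\<exists>\<mu> \<in> homogeneous_quasimorphisms G. restr N \<mu> = \<nu>))"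
proof -
  interpret normal N G
    by fact
  interpret euler_primitive N G \<rho> A u
    using assms by unfold_locales (simp_all add: p_def Gamma_def)
  have trivial: "cohomology_pullback G \<rho> 2 real_euler_class = \<one>\<^bsub>cohomology G 2\<^esub>"
    if "\<phi> \<in> invariant_homs G N" "\<mu> \<in> homogeneous_quasimorphisms G" and decomp: "\<nu> = (\<lambda>x. \<phi> x + restr N \<mu> x)"
    for \<phi> \<mu>
  proof -
    have "u [x] = \<phi> x + \<mu> x" if "x \<in> N" for x
      using fun_cong[OF decomp, of x] that by (simp add: nu_def restr_def)
    then have "cochain_pullback G \<rho> 2 euler_cocycle \<in> coboundaries G (cochains G) 2"
      using euler_class_trivial_if_decomposes[OF _ assms(9) _ that(1,2)] assms(7,12)
      unfolding Gamma_def by simp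
    then show ?thesis
      unfolding real_euler_class_def cohomology_pullback_class[OF assms(5)]
      by (rule cohomology_class_trivial)
  qed
  have "cohomology_pullback G \<rho> 2 real_euler_class = \<one>\<^bsub>cohomology G 2\<^esub>"
    if zero_class: "W_class G N \<nu> = \<one>\<^bsub>W_space G N\<^esub>"
  proof -
    obtain \<phi> \<mu> where "\<phi> \<in> invariant_homs G N" "\<mu> \<in> homogeneous_quasimorphisms G"
      "\<nu> = (\<lambda>x. \<phi> x + restr N \<mu> x)"
      using W_class_trivialD[OF zero_class] by (auto simp: W_denominator_iff)
    then show ?thesis
      by (rule trivial)
  qed
  moreover have "cohomology_pullback G \<rho> 2 real_euler_class = \<one>\<^bsub>cohomology G 2\<^esub>"
    if "\<mu> \<in> homogeneous_quasimorphisms G" "restr N \<mu> = \<nu>" for \<mu>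
    using trivial[OF zero_invariant_hom that(1)] that(2) by simp
  ultimately show ?thesis
    using primitive_restr_invariant_quasimorphism unfolding nu_def by metis
qed

end
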